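(* Let $\mathcal{K}\subset\mathbb{R}^n$ be a proper convex cone whose dual cone $\mathcal{K}^*$ admits a $\nu$-LHSCB $f_{\mathcal{K}^*}:(\mathcal{K}^* )^\circ\to\mathbb{R}$ with Hessian $H_{\mathcal{K}^*}$. Let $A\in\mathbb{R}^{m\times n}$, $b\in\mathbb{R}^m$, $c\in\mathbb{R}^n$, and consider the primal-dual pair $$\text{(P)}\ \ \inf_x\{c^{\mathrm T}x : Ax=b,\ x\in\mathcal{K}\},\qquad \text{(D)}\ \ \sup_{y,s}\{b^{\mathrm T}y : A^{\mathrm T}y+s=c,\ s\in\mathcal{K}^*\}.$$ Let $$\mathcal{K}_{c,A}=\left\{\begin{pmatrix}c^{\mathrm T}x\\ -Ax\end{pmatrix} : x\in\mathcal{K}\right\}\subset\mathbb{R}^{m+1},\qquad A_c=\begin{pmatrix}c^{\mathrm T}\\ -A\end{pmatrix}.$$ Assume that (P) and (D) are both feasible, that $A_c$ has linearly independent rows, and that $(\mathcal{K}_{c,A}^* )^\circ$ is non-empty and is the domain $\{(y_0,y)\in\mathbb{R}\times\mathbb{R}^m : cy_0-A^{\mathrm T}y\in(\mathcal{K}^* )^\circ\}$ of the $\nu$-LHSCB $$f_{\mathcal{K}_{c,A}^*}(y_0,y)=f_{\mathcal{K}^*}(cy_0-A^{\mathrm T}y).$$ Let $y\in\mathbb{R}^m$ with $(1,y)\in(\mathcal{K}_{c,A}^* )^\circ$ (equivalently, $(y,s)$ is a feasible solution of (D) for some $s\in(\mathcal{K}^* )^\circ$), and let $\gamma\in\mathbb{R}$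 be arbitrary. Then the vector $$x_\gamma=H_{\mathcal{K}^*}(\upsilon)A_c^{\mathrm T}\left(A_cH_{\mathcal{K}^*}(\upsilon)A_c^{\mathrm T}\right)^{-1}b_\gamma,\qquad b_\gamma=\begin{pmatrix}\gamma\\ -b\end{pmatrix},\quad \upsilon=A_c^{\mathrm T}\begin{pmatrix}1\\ y\end{pmatrix},$$ satisfies $Ax_\gamma=b$ and $c^{\mathrm T}x_\gamma=\gamma$. Moreover, let $\tau>0$ and let $y_\tau$ be the unique minimizer $$y_\tau=\arg\min\left\{\tau f_{\mathcal{K}_{c,A}^*}(y_0,y)-b^{\mathrm T}y : y_0=1,\ (y_0,y)\in(\mathcal{K}_{c,A}^* )^\circ\right\}.$$ If $y$ is sufficiently close to $y_\tau$ (i.e., $y$ lies in some neighborhood of $y_\tau$, depending on $\tau$ and the problem data) and $\gamma=b^{\mathrm T}y+\nu\tau$, then $x_\gamma\in\mathcal{K}$; that is, $x_\gamma$ is a feasible solution of (P), and its objective value is no more than $\nu\tau$ away from the optimal value of (P).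
   Context: A proper convex cone is a closed convex cone that is pointed and has non-empty interior. $\mathcal{C}^\circ$ denotes the interior of $\mathcal{C}$. The dual of a cone $\mathcal{C}\subset\mathbb{R}^k$ is $\mathcal{C}^*=\{y\in\mathbb{R}^k : x^{\mathrm T}y\ge 0 \text{ for all } x\in\mathcal{C}\}$. A (strongly nondegenerate) self-concordant barrier (SCB) for a convex cone $\mathcal{C}$ with non-empty interior is a strictly convex, at least three times differentiable function $f:\mathcal{C}^\circ\to\mathbb{R}$ with positive definite Hessian everywhere such that, with $g$ and $H$ denoting the gradient and Hessian of $f$: (1) $f(x)\to\infty$ as $x$ tends to the boundary of $\mathcal{C}$; (2) $|D^3f(x)[h,h,h]|\le 2\,(D^2f(x)[h,h])^{3/2}$ for all $x\in\mathcal{C}^\circ$ and all directions $h$; (3) $\nu:=\sup_{x\in\mathcal{C}^\circ} g(x)^{\mathrm T}H(x)^{-1}g(x)<\infty$. It is a $\nu$-LHSCB (logarithmically homogeneous self-concordant barrier with parameter $\nu$) if in addition $f(tx)=f(x)-\nu\ln t$ for all $x\in\mathcal{C}^\circ$, $t>0$. The existence of the unique minimizer $y_\tau$ is taken as part of the setting (it is the point with parameter $\tau$ on the dual central path). *)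

theory Defs
  imports "HOL-Analysis.Analysis"
begin

definition proper_cone :: "'a::euclidean_space set \<Rightarrow> bool" where
  "proper_cone K \<longleftrightarrow> closed K \<and> convex_cone K \<and> (\<forall>x. x \<in> K \<and> - x \<in> K \<longrightarrow> x = 0) \<and> interior K \<noteq> {}"

definition dual_cone :: "'a::euclidean_space set \<Rightarrow> 'a set" where
  "dual_cone C = {y. \<forall>x\<in>C. 0 \<le> x \<bullet> y}"

definition grad :: "(real^'k \<Rightarrow> real) \<Rightarrow> real^'k \<Rightarrow> real^'k" where
  "grad f x = (THE g. GDERIV f x :> g)"

definition hessian :: "(real^'k \<Rightarrow> real) \<Rightarrow> real^'k \<Rightarrow> real^'k^'k" where
  "hessian f x = jacobian (grad f) (at x)"

definition D2 :: "(real^'k \<Rightarrow> real) \<Rightarrow> real^'k \<Rightarrow> real^'k \<Rightarrow> real" where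
  "D2 f x h = h \<bullet> (hessian f x *v h)"

text \<open>\<open>D3 f x h\<close> is $D^3 f(x)[h,h,h]$: the matrix-valued map \<open>hessian f\<close> is differentiated
  in the direction \<open>h\<close>, and the resulting matrix is evaluated as a quadratic form at \<open>h\<close>.\<close>

definition D3 :: "(real^'k \<Rightarrow> real) \<Rightarrow> real^'k \<Rightarrow> real^'k \<Rightarrow> real" where
  "D3 f x h = h \<bullet> (frechet_derivative (hessian f) (at x) h *v h)"

definition three_times_differentiable_on :: "(real^'k \<Rightarrow> real) \<Rightarrow> (real^'k) set \<Rightarrow> bool" where
  "three_times_differentiable_on f U \<longleftrightarrow>
     (\<forall>x\<in>U. f differentiable (at x) \<and> grad f differentiable (at x) \<and> hessian f differentiable (at x))"

definition strictly_convex_on :: "'a::real_vector set \<Rightarrow> ('a \<Rightarrow> real) \<Rightarrow> bool" where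
  "strictly_convex_on U f \<longleftrightarrow> convex U \<and>
     (\<forall>x\<in>U. \<forall>y\<in>U. \<forall>t. x \<noteq> y \<longrightarrow> 0 < t \<longrightarrow> t < 1 \<longrightarrow>
        f ((1 - t) *\<^sub>R x + t *\<^sub>R y) < (1 - t) * f x + t * f y)"

text \<open>The real supremum in \<open>barrier_parameter\<close> is meaningful only when the set of values is
  bounded above, which is part of \<open>scb\<close>. Functions are total; values of \<open>f\<close> outside
  \<open>interior C\<close> are irrelevant. The Hessian of a twice differentiable function is
  automatically symmetric, so positive definiteness is stated through the quadratic form only.\<close>

definition newton_values :: "(real^'k) set \<Rightarrow> (real^'k \<Rightarrow> real) \<Rightarrow> real set" where
  "newton_values C f =
     (\<lambda>x. grad f x \<bullet> (matrix_inv (hessian f x) *v grad f x)) ` interior C"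

definition barrier_parameter :: "(real^'k) set \<Rightarrow> (real^'k \<Rightarrow> real) \<Rightarrow> real" where
  "barrier_parameter C f = Sup (newton_values C f)"

definition scb :: "(real^'k) set \<Rightarrow> (real^'k \<Rightarrow> real) \<Rightarrow> bool" where
  "scb C f \<longleftrightarrow>
     convex_cone C \<and> interior C \<noteq> {} \<and>
     strictly_convex_on (interior C) f \<and>
     three_times_differentiable_on f (interior C) \<and>
     (\<forall>x\<in>interior C. \<forall>h. h \<noteq> 0 \<longrightarrow> 0 < D2 f x h) \<and>
     (\<forall>z\<in>frontier C. filterlim f at_top (at z within interior C)) \<and>
     (\<forall>x\<in>interior C. \<forall>h. \<bar>D3 f x h\<bar> \<le> 2 * D2 f x h powr (3/2)) \<and>
     bdd_above (newton_values C f)"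

definition lhscb :: "real \<Rightarrow> (real^'k) set \<Rightarrow> (real^'k \<Rightarrow> real) \<Rightarrow> bool" where
  "lhscb \<nu> C f \<longleftrightarrow>
     scb C f \<and> \<nu> = barrier_parameter C f \<and>
     (\<forall>x\<in>interior C. \<forall>t>0. f (t *\<^sub>R x) = f x - \<nu> * ln t)"

definition primal_feasible :: "(real^'n) set \<Rightarrow> real^'n^'m \<Rightarrow> real^'m \<Rightarrow> (real^'n) set" where
  "primal_feasible K A b = {x. A *v x = b \<and> x \<in> K}"

definition dual_feasible :: "(real^'n) set \<Rightarrow> real^'n^'m \<Rightarrow> real^'n \<Rightarrow> ((real^'m) \<times> (real^'n)) set" where
  "dual_feasible K A c = {(y, s). transpose A *v y + s = c \<and> s \<in> dual_cone K}"

text \<open>A real infimum; by weak duality the set is non-empty and bounded below as soon as both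
  problems are feasible.\<close>

definition primal_value :: "(real^'n) set \<Rightarrow> real^'n^'m \<Rightarrow> real^'m \<Rightarrow> real^'n \<Rightarrow> real" where
  "primal_value K A b c = Inf ((\<lambda>x. c \<bullet> x) ` primal_feasible K A b)"

text \<open>$\mathbb{R}^{m+1}$ is \<open>real^'m option\<close>, the extra coordinate 0 being \<open>None\<close>. The function
  \<open>stack\<close> puts an entry on top of a vector; as a matrix is a vector of rows, it also puts a row
  on top of a matrix.\<close>

definition stack :: "'a \<Rightarrow> 'a^'m \<Rightarrow> 'a^('m option)" where
  "stack a v = (\<chi> i. case i of None \<Rightarrow> a | Some j \<Rightarrow> v $ j)"

definition A_c :: "real^'n \<Rightarrow> real^'n^'m \<Rightarrow> real^'n^('m option)" where
  "A_c c A = stack c (- A)"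

definition K_cA :: "(real^'n) set \<Rightarrow> real^'n \<Rightarrow> real^'n^'m \<Rightarrow> (real^('m option)) set" where
  "K_cA K c A = {stack (c \<bullet> x) (- (A *v x)) | x. x \<in> K}"

definition f_cA :: "(real^'n \<Rightarrow> real) \<Rightarrow> real^'n \<Rightarrow> real^'n^'m \<Rightarrow> real^('m option) \<Rightarrow> real" where
  "f_cA f c A z = f (z $ None *\<^sub>R c - transpose A *v (\<chi> j. z $ Some j))"

text \<open>Linear independence of the rows as a family (repeated rows are dependent), whereas
  \<open>independent (rows M)\<close> would only see the set of rows.\<close>

definition independent_rows :: "real^'n^'k \<Rightarrow> bool" where
  "independent_rows M \<longleftrightarrow> (\<forall>u. (\<Sum>i\<in>UNIV. u i *\<^sub>R row i M) = 0 \<longrightarrow> (\<forall>i. u i = 0))"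

definition upsilon :: "real^'n \<Rightarrow> real^'n^'m \<Rightarrow> real^'m \<Rightarrow> real^'n" where
  "upsilon c A y = transpose (A_c c A) *v stack 1 y"

definition normal_matrix ::
    "(real^'n \<Rightarrow> real) \<Rightarrow> real^'n \<Rightarrow> real^'n^'m \<Rightarrow> real^'m \<Rightarrow> real^('m option)^('m option)" where
  "normal_matrix f c A y = A_c c A ** hessian f (upsilon c A y) ** transpose (A_c c A)"

definition x_gamma ::
    "(real^'n \<Rightarrow> real) \<Rightarrow> real^'n \<Rightarrow> real^'n^'m \<Rightarrow> real^'m \<Rightarrow> real^'m \<Rightarrow> real \<Rightarrow> real^'n" where
  "x_gamma f c A b y \<gamma> =
     (hessian f (upsilon c A y) ** transpose (A_c c A) ** matrix_inv (normal_matrix f c A y))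
       *v stack \<gamma> (- b)"

definition unique_minimizer :: "('a \<Rightarrow> real) \<Rightarrow> ('a \<Rightarrow> bool) \<Rightarrow> 'a \<Rightarrow> bool" where
  "unique_minimizer \<phi> P w \<longleftrightarrow> is_arg_min \<phi> P w \<and> (\<forall>w'. is_arg_min \<phi> P w' \<longrightarrow> w' = w)"

definition dual_central_point ::
    "(real^'n) set \<Rightarrow> (real^'n \<Rightarrow> real) \<Rightarrow> real^'n \<Rightarrow> real^'n^'m \<Rightarrow> real^'m \<Rightarrow> real \<Rightarrow> real^'m \<Rightarrow> bool" where
  "dual_central_point K f c A b \<tau> y\<^sub>\<tau> \<longleftrightarrow>
     unique_minimizer (\<lambda>(y\<^sub>0, y). \<tau> * f_cA f c A (stack y\<^sub>0 y) - b \<bullet> y)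
       (\<lambda>(y\<^sub>0, y). y\<^sub>0 = 1 \<and> stack y\<^sub>0 y \<in> interior (dual_cone (K_cA K c A)))
       (1, y\<^sub>\<tau>)"

end

theory Submission
  imports Defs "HOL-Real_Asymp.Real_Asymp"
begin

text \<open>
  Write \<open>g\<close>, \<open>H\<close> for the gradient and Hessian of \<open>f\<close>. Logarithmic homogeneity gives
  \<open>g (t s) = g s / t\<close>, hence \<open>s \<bullet> g s = - \<nu>\<close> and \<open>H s s = - g s\<close>. Let \<open>s\<close> be the slack of the central
  point \<open>y\<^sub>\<tau>\<close> and \<open>x = - \<tau> g s\<close>. Stationarity of \<open>y\<^sub>\<tau>\<close> says \<open>A x = b\<close>, so \<open>c \<bullet> x = b \<bullet> y\<^sub>\<tau> + \<nu> \<tau>\<close>;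
  as \<open>x = H s (\<tau> s)\<close> and \<open>s\<close> is in the range of the transpose of \<open>A_c\<close>, \<open>x\<close> is the vector
  \<open>x_gamma\<close> at \<open>y\<^sub>\<tau>\<close>. Strict convexity makes \<open>g s\<close> negative on the nonzero dual cone, so \<open>x\<close> lies in the
  interior of \<open>K\<close>, and by continuity \<open>x_gamma\<close> stays in \<open>K\<close> near \<open>y\<^sub>\<tau>\<close>. Weak duality
  bounds the gap.
\<close>

section \<open>Stacked matrices\<close>

lemma stack_eq_iff [simp]: "stack a v = stack a' v' \<longleftrightarrow> a = a' \<and> v = v'"
  unfolding stack_def vec_eq_iff by (auto split: option.splits)

text \<open>The index type \<open>'m option\<close> is the disjoint union of \<open>{None}\<close>
  and \<open>range Some\<close>, and the sum splits accordingly.\<close>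

lemma stack_inner_stack:
  fixes v w :: "real^'m"
  shows "stack a v \<bullet> stack a' w = a * a' + v \<bullet> w"
proof -
  have "stack a v \<bullet> stack a' w = (\<Sum>i\<in>insert None (range Some). stack a v $ i * stack a' w $ i)"
    by (simp add: inner_vec_def UNIV_option_conv)
  also have "\<dots> = a * a' + (\<Sum>i\<in>range Some. stack a v $ i * stack a' w $ i)"
    by (subst sum.insert) (auto simp: stack_def)
  also have "(\<Sum>i\<in>range Some. stack a v $ i * stack a' w $ i) = v \<bullet> w"
    by (subst sum.reindex) (auto simp: stack_def inner_vec_def)
  finally show ?thesis .
qed

lemma A_c_mult: "A_c c A *v x = stack (c \<bullet> x) (- (A *v x))"
  unfolding A_c_def stack_def vec_eq_iff
  by (auto simp: matrix_vector_mult_def inner_vec_def sum_negf split: option.splits)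

lemma A_c_transpose_mult:
  fixes c :: "real^'n"
  shows "transpose (A_c c A) *v stack a v = a *\<^sub>R c - transpose A *v v"
proof (rule vector_eq_rdot[THEN iffD1], intro allI)
  fix x :: "real^'n"
  show "(transpose (A_c c A) *v stack a v) \<bullet> x = (a *\<^sub>R c - transpose A *v v) \<bullet> x"
    by (simp add: dot_lmul_matrix A_c_mult stack_inner_stack inner_diff_left)
qed

lemma upsilon_eq: "upsilon c A y = c - transpose A *v y"
  unfolding upsilon_def A_c_transpose_mult by simp

lemma f_cA_stack: "f_cA f c A (stack a y) = f (a *\<^sub>R c - transpose A *v y)"
  by (simp add: f_cA_def stack_def)

section \<open>Matrices\<close>

lemma invertible_congruence:
  fixes H :: "real^'n^'n" and B :: "real^'n^'k"
  assumes pos: "\<And>h. h \<noteq> 0 \<Longrightarrow> 0 < h \<bullet> (H *v h)" and ind: "independent_rows B"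
  shows "invertible (B ** H ** transpose B)"
proof -
  have inj_transpose: "transpose B *v u \<noteq> 0" if "u \<noteq> 0" for u
  proof -
    \<comment> \<open>Row independence yields a right inverse of \<open>B\<close>; its transpose is
      a left inverse of \<open>transpose B\<close>.\<close>
    obtain B' where "B ** B' = mat 1"
      using ind matrix_right_invertible_independent_rows[of B] unfolding independent_rows_def
      by (auto simp: scalar_mult_eq_scaleR)
    then have "transpose B' *v (transpose B *v u) = u"
      by (metis matrix_transpose_mul matrix_vector_mul_assoc matrix_vector_mul_lid transpose_mat)
    with that show ?thesis
      by (metis matrix_vector_mult_0_right)
  qed
  have "u = 0" if "(B ** H ** transpose B) *v u = 0" for u
  proof (rule ccontr)
    \<comment> \<open>A kernel vector \<open>u\<close> gives
      \<open>?h \<bullet> (H *v ?h) = 0\<close> for \<open>?h = transpose B *v u\<close>, against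
      positivity at \<open>?h \<noteq> 0\<close>.\<close>
    assume "u \<noteq> 0"
    let ?h = "transpose B *v u"
    have "0 < ?h \<bullet> (H *v ?h)"
      using pos inj_transpose[OF \<open>u \<noteq> 0\<close>] by blast
    also have "\<dots> = u \<bullet> (B *v (H *v ?h))"
      by (simp add: dot_lmul_matrix)
    also have "B *v (H *v ?h) = (B ** H ** transpose B) *v u"
      by (simp only: matrix_vector_mul_assoc matrix_mul_assoc)
    finally show False
      using that by simp
  qed
  then show ?thesis
    by (metis invertible_left_inverse matrix_left_invertible_ker)
qed

lemma matrix_inv_mult:
  fixes N :: "real^'k^'k"
  assumes "invertible N"
  shows "N *v (matrix_inv N *v w) = w" "matrix_inv N *v (N *v w) = w"
proof -
  have "N ** matrix_inv N = mat 1 \<and> matrix_inv N ** N = mat 1"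
    using assms unfolding invertible_def matrix_inv_def by (rule someI_ex)
  then show "N *v (matrix_inv N *v w) = w" "matrix_inv N *v (N *v w) = w"
    by (auto simp: matrix_vector_mul_assoc)
qed

lemma tendsto_matrix_mult:
  fixes M :: "'a \<Rightarrow> real^'n^'m" and N :: "'a \<Rightarrow> real^'k^'n"
  assumes "(M \<longlongrightarrow> M0) F" "(N \<longlongrightarrow> N0) F"
  shows "((\<lambda>x. M x ** N x) \<longlongrightarrow> M0 ** N0) F"
  unfolding matrix_matrix_mult_def using assms by (auto intro!: tendsto_intros)

lemma tendsto_matrix_vector_mult:
  fixes M :: "'a \<Rightarrow> real^'n^'m" and v :: "'a \<Rightarrow> real^'n"
  assumes "(M \<longlongrightarrow> M0) F" "(v \<longlongrightarrow> v0) F"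
  shows "((\<lambda>x. M x *v v x) \<longlongrightarrow> M0 *v v0) F"
  unfolding matrix_vector_mult_def using assms by (auto intro!: tendsto_intros)

lemma tendsto_det:
  fixes M :: "'a \<Rightarrow> real^'n^'n"
  assumes "(M \<longlongrightarrow> M0) F"
  shows "((\<lambda>x. det (M x)) \<longlongrightarrow> det M0) F"
  unfolding det_def using assms by (auto intro!: tendsto_intros)

text \<open>Cramer's rule writes the solution of the linear system as a quotient of determinants,
  and these are continuous in the entries.\<close>

lemma tendsto_matrix_inv_mult:
  fixes N :: "'a \<Rightarrow> real^'k^'k" and w :: "'a \<Rightarrow> real^'k"
  assumes N: "(N \<longlongrightarrow> N0) F" and w: "(w \<longlongrightarrow> w0) F" and inv: "invertible N0"
  shows "((\<lambda>x. matrix_inv (N x) *v w x) \<longlongrightarrow> matrix_inv N0 *v w0) F"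
proof -
  let ?u = "\<lambda>N w. (\<chi> k. det (\<chi> i j. if j = k then w $ i else N $ i $ j) / det N) :: real^'k"
  have cramer_inv: "matrix_inv N *v w = ?u N w" if "det N \<noteq> 0" for N :: "real^'k^'k" and w
    using cramer[OF that] matrix_inv_mult(1) that unfolding invertible_det_nz[symmetric] by blast
  have det0: "det N0 \<noteq> 0"
    using inv by (simp add: invertible_det_nz)
  \<comment> \<open>Entries of a Cramer matrix are chosen by the column index alone, so the
    condition does not vary along the filter.\<close>
  have ite: "((\<lambda>x. if P then p x else q x) \<longlongrightarrow> (if P then p0 else q0)) F"
    if "(p \<longlongrightarrow> p0) F" "(q \<longlongrightarrow> q0) F" for P and p q :: "'a \<Rightarrow> real" and p0 q0
    using that by simp
  have "((\<lambda>x. ?u (N x) (w x)) \<longlongrightarrow> ?u N0 w0) F"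
    by (intro tendsto_vec_lambda tendsto_divide tendsto_det ite tendsto_vec_nth N w det0)
  then have "((\<lambda>x. ?u (N x) (w x)) \<longlongrightarrow> matrix_inv N0 *v w0) F"
    by (simp only: cramer_inv[OF det0])
  \<comment> \<open>The limit determinant is nonzero, so Cramer's formula is eventually valid for
    \<open>N x\<close> too.\<close>
  moreover have "\<forall>\<^sub>F x in F. det (N x) \<noteq> 0"
    using tendsto_det[OF N] det0 by (rule tendsto_imp_eventually_ne)
  then have "\<forall>\<^sub>F x in F. ?u (N x) (w x) = matrix_inv (N x) *v w x"
    by eventually_elim (simp add: cramer_inv)
  ultimately show ?thesis
    by (rule Lim_transform_eventually)
qed

section \<open>Convex cones\<close>

text \<open>The translate of the interior by \<open>u\<close> is an open subset of
  \<open>C\<close>.\<close>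

lemma convex_cone_interior_add:
  fixes C :: "'a::euclidean_space set"
  assumes "convex_cone C" "s \<in> interior C" "u \<in> C"
  shows "s + u \<in> interior C"
proof -
  have "(+) u ` interior C \<subseteq> interior C"
    using assms(1,3) interior_subset
    by (intro interior_maximal open_translation) (auto intro!: convex_cone_add)
  with assms(2) show ?thesis
    by (auto simp: add.commute)
qed

lemma convex_cone_interior_scaleR:
  fixes C :: "'a::euclidean_space set"
  assumes "convex_cone C" "s \<in> interior C" "0 < t"
  shows "t *\<^sub>R s \<in> interior C"
proof -
  have "(*\<^sub>R) t ` interior C \<subseteq> interior C"
    using assms(1,3) interior_subset
    by (intro interior_maximal open_scaling) (auto intro!: convex_cone_scaleR)
  with assms(2) show ?thesis
    by auto
qed

section \<open>Dual cones and separation\<close>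

lemma closed_dual_cone: "closed (dual_cone C)"
proof -
  have "dual_cone C = (\<Inter>x\<in>C. {y. 0 \<le> x \<bullet> y})"
    by (auto simp: dual_cone_def)
  then show ?thesis
    by (auto intro!: closed_INT simp: closed_halfspace_ge)
qed

lemma dual_cone_scaleR: "u \<in> dual_cone C \<Longrightarrow> 0 \<le> t \<Longrightarrow> t *\<^sub>R u \<in> dual_cone C"
  by (auto simp: dual_cone_def)

text \<open>A hyperplane separating \<open>x\<close> from \<open>K\<close> has, by homogeneity of
  \<open>K\<close>, a normal in the dual cone on which \<open>x\<close> is negative.\<close>

lemma bipolar_subset:
  fixes K :: "'a::euclidean_space set"
  assumes "closed K" and cone: "convex_cone K" and x: "\<And>u. u \<in> dual_cone K \<Longrightarrow> 0 \<le> x \<bullet> u"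
  shows "x \<in> K"
proof (rule ccontr)
  assume "x \<notin> K"
  with assms obtain a \<beta> where a: "a \<bullet> x < \<beta>" "\<And>z. z \<in> K \<Longrightarrow> \<beta> < a \<bullet> z"
    using separating_hyperplane_closed_point[of K x] unfolding convex_cone_def by blast
  have "0 \<in> K"
    using cone by (simp add: convex_cone_iff)
  with a(2)[of 0] have \<beta>: "\<beta> < 0"
    by simp
  have "0 \<le> z \<bullet> a" if "z \<in> K" for z
  proof (rule ccontr)
    assume neg: "\<not> 0 \<le> z \<bullet> a"
    \<comment> \<open>Both \<beta> and \<open>z \<bullet> a\<close> are negative. The factor makes
      the inner product with \<open>a\<close> equal to \<beta>, contradicting strict
      separation.\<close>
    then have "(\<beta> / (z \<bullet> a)) *\<^sub>R z \<in> K"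
      using cone \<beta> that by (intro convex_cone_scaleR) (auto simp: divide_nonpos_neg)
    from a(2)[OF this] neg show False
      by (simp add: inner_commute)
  qed
  then have "a \<in> dual_cone K"
    by (simp add: dual_cone_def)
  from x[OF this] a(1) \<beta> show False
    by (simp add: inner_commute)
qed

text \<open>Compactness of the unit vectors of the dual cone makes positivity uniform, with bound
  \<mu>; moving \<open>x\<close> by less than \<mu> keeps it in the bidual, which is contained in
  \<open>K\<close>.\<close>

lemma interior_if_pos_on_dual_cone:
  fixes K :: "'a::euclidean_space set"
  assumes "closed K" "convex_cone K" and pos: "\<And>u. u \<in> dual_cone K \<Longrightarrow> u \<noteq> 0 \<Longrightarrow> 0 < x \<bullet> u"
  shows "x \<in> interior K"
proof -
  let ?S = "dual_cone K \<inter> sphere 0 1"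
  obtain \<mu> where \<mu>: "0 < \<mu>" "\<And>u. u \<in> ?S \<Longrightarrow> \<mu> \<le> x \<bullet> u"
  proof (cases "?S = {}")
    case False
    have "compact ?S"
      by (intro closed_Int_compact closed_dual_cone) auto
    moreover have "continuous_on ?S (\<lambda>u. x \<bullet> u)"
      by (intro continuous_intros)
    ultimately obtain u where u: "u \<in> ?S" "\<And>v. v \<in> ?S \<Longrightarrow> x \<bullet> u \<le> x \<bullet> v"
      using continuous_attains_inf False by metis
    then show thesis
      using pos[of u] norm_zero by (intro that[of "x \<bullet> u"]) fastforce+
  \<comment> \<open>Without unit vectors in the dual cone the bound is vacuous, and 1 serves as
    \<mu>.\<close>
  qed (auto intro: that[of 1])
  have "ball x \<mu> \<subseteq> K"
  proof
    fix z assume "z \<in> ball x \<mu>"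
    then have z: "norm (x - z) < \<mu>"
      by (simp add: dist_norm)
    have "0 \<le> z \<bullet> u" if u: "u \<in> dual_cone K" for u
    proof (cases "u = 0")
      case False
      let ?v = "(1 / norm u) *\<^sub>R u"
      have v: "?v \<in> ?S"
        using False u by (auto intro: dual_cone_scaleR)
      have "\<mu> \<le> x \<bullet> ?v"
        using \<mu>(2) v by blast
      moreover have "(x - z) \<bullet> ?v \<le> norm (x - z) * norm ?v"
        by (rule norm_cauchy_schwarz)
      moreover have "norm ?v = 1"
        using False by simp
      ultimately have "0 \<le> z \<bullet> ?v"
        using z by (simp only: inner_diff_left)
      then show ?thesis
        using False by (simp add: zero_le_divide_iff)
    qed simp
    then show "z \<in> K"
      using assms(1,2) by (intro bipolar_subset)
  qed
  with \<mu>(1) show ?thesis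
    by (auto simp: mem_interior)
qed

section \<open>Logarithmically homogeneous barriers\<close>

lemma has_derivative_grad:
  assumes "f differentiable (at x)"
  shows "(f has_derivative (\<lambda>h. h \<bullet> grad f x)) (at x)"
proof -
  from assms obtain f' where f': "(f has_derivative f') (at x)"
    unfolding differentiable_def by blast
  \<comment> \<open>The Riesz vector of the functional \<open>f'\<close>. Its uniqueness, shown
    below, gives meaning to the definite description in \<open>grad\<close>.\<close>
  let ?g = "adjoint f' 1"
  have lin: "linear f'"
    using f' by (rule has_derivative_linear)
  have "f' h = h \<bullet> ?g" for h
    using adjoint_works[OF lin, of h 1] by simp
  then have "f' = (\<lambda>h. h \<bullet> ?g)"
    by blast
  with f' have g: "GDERIV f x :> ?g"
    by (simp only: gderiv_def)
  have "D = ?g" if "GDERIV f x :> D" for D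
  proof -
    have "(\<lambda>h. h \<bullet> D) = (\<lambda>h. h \<bullet> ?g)"
      using g that unfolding gderiv_def by (blast intro: has_derivative_unique)
    then show ?thesis
      by (metis vector_eq_ldot)
  qed
  with g have "GDERIV f x :> grad f x"
    unfolding grad_def by (rule theI)
  then show ?thesis
    by (simp add: gderiv_def)
qed

lemma has_derivative_hessian:
  assumes "grad f differentiable (at x)"
  shows "(grad f has_derivative (\<lambda>h. hessian f x *v h)) (at x)"
  using assms unfolding hessian_def jacobian_works .

section \<open>Tangent inequalities for strictly convex functions\<close>

lemma has_real_derivative_ray:
  fixes f :: "real^'n \<Rightarrow> real"
  assumes "f differentiable (at (x + t *\<^sub>R d))"
  shows "((\<lambda>t. f (x + t *\<^sub>R d)) has_real_derivative d \<bullet> grad f (x + t *\<^sub>R d)) (at t)"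
proof -
  have "((\<lambda>t. x + t *\<^sub>R d) has_derivative (\<lambda>h. h *\<^sub>R d)) (at t)"
    by (auto intro!: derivative_eq_intros)
  from has_derivative_compose[OF this has_derivative_grad[OF assms]]
  show ?thesis
    unfolding has_field_derivative_def by (rule has_derivative_eq_rhs) (simp add: fun_eq_iff)
qed

text \<open>Convexity bounds the difference quotients on the segment from \<open>x\<close> to
  \<open>y\<close> by \<open>f y - f x\<close>; strictness may be lost in the limit at 0.\<close>

lemma strictly_convex_gradient_le:
  fixes f :: "real^'n \<Rightarrow> real"
  assumes sc: "strictly_convex_on U f" and diff: "f differentiable (at x)"
    and xy: "x \<in> U" "y \<in> U"
  shows "(y - x) \<bullet> grad f x \<le> f y - f x"
proof (cases "x = y")
  case False
  let ?\<phi> = "\<lambda>t. f (x + t *\<^sub>R (y - x))"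
  have "(?\<phi> has_real_derivative (y - x) \<bullet> grad f x) (at 0)"
    using has_real_derivative_ray[of f x 0 "y - x"] diff by simp
  then have "((\<lambda>t. (?\<phi> t - ?\<phi> 0) / t) \<longlongrightarrow> (y - x) \<bullet> grad f x) (at_right 0)"
    by (auto simp: has_field_derivative_iff intro: filterlim_mono at_le)
  then show ?thesis
  proof (rule tendsto_upperbound)
    show "\<forall>\<^sub>F t in at_right 0. (?\<phi> t - ?\<phi> 0) / t \<le> f y - f x"
      using eventually_at_right_real[of 0 "1::real", simplified]
    proof eventually_elim
      case (elim t)
      have "x + t *\<^sub>R (y - x) = (1 - t) *\<^sub>R x + t *\<^sub>R y"
        by (simp add: algebra_simps)
      then have "?\<phi> t < (1 - t) * f x + t * f y"
        using sc xy False elim unfolding strictly_convex_on_def by simp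
      then show ?case
        using elim by (simp add: field_simps)
    qed
  qed simp
qed simp

text \<open>Strictness is recovered by using the weak inequality at the midpoint, where
  \<open>f\<close> lies strictly below the chord.\<close>

lemma strictly_convex_gradient_less:
  fixes f :: "real^'n \<Rightarrow> real"
  assumes sc: "strictly_convex_on U f" and diff: "f differentiable (at x)"
    and xy: "x \<in> U" "y \<in> U" "x \<noteq> y"
  shows "(y - x) \<bullet> grad f x < f y - f x"
proof -
  let ?m = "(1 - 1/2) *\<^sub>R x + (1/2) *\<^sub>R y"
  have "?m \<in> U"
    using sc xy unfolding strictly_convex_on_def by (intro convexD) auto
  then have "(?m - x) \<bullet> grad f x \<le> f ?m - f x"
    by (intro strictly_convex_gradient_le[OF sc diff xy(1)])
  moreover have "f ((1 - t) *\<^sub>R x + t *\<^sub>R y) < (1 - t) * f x + t * f y" if "0 < t" "t < 1" for t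
    using sc xy that unfolding strictly_convex_on_def by blast
  from this[of "1/2"] have "f ?m < (1 - 1/2) * f x + (1/2) * f y"
    by simp
  moreover have "?m - x = (1/2) *\<^sub>R (y - x)"
    by (simp only: scaleR_diff_left scaleR_diff_right scaleR_one) simp
  ultimately show ?thesis
    by simp
qed

section \<open>Consequences of logarithmic homogeneity\<close>

context
  fixes C :: "(real^'n) set" and f :: "real^'n \<Rightarrow> real" and \<nu> :: real
  assumes lhscb: "lhscb \<nu> C f"
begin

lemma lhscb_convex_cone: "convex_cone C"
  and lhscb_strictly_convex: "strictly_convex_on (interior C) f"
  and lhscb_log_homogeneous: "x \<in> interior C \<Longrightarrow> 0 < t \<Longrightarrow> f (t *\<^sub>R x) = f x - \<nu> * ln t"
  and lhscb_differentiable: "x \<in> interior C \<Longrightarrow> f differentiable (at x)"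
  and lhscb_grad_differentiable: "x \<in> interior C \<Longrightarrow> grad f differentiable (at x)"
  and lhscb_hessian_pos: "x \<in> interior C \<Longrightarrow> h \<noteq> 0 \<Longrightarrow> 0 < h \<bullet> (hessian f x *v h)"
  and lhscb_isCont_hessian: "x \<in> interior C \<Longrightarrow> isCont (hessian f) x"
  using lhscb
  unfolding lhscb_def scb_def three_times_differentiable_on_def D2_def
  by (auto intro: differentiable_imp_continuous_within)

text \<open>Differentiate \<open>f (t *\<^sub>R x) = f x - \<nu> * ln t\<close> in \<open>t\<close>
  at 1.\<close>

lemma lhscb_grad_inner_self:
  assumes x: "x \<in> interior C"
  shows "x \<bullet> grad f x = - \<nu>"
proof -
  have "((\<lambda>t. f (0 + t *\<^sub>R x)) has_real_derivative x \<bullet> grad f x) (at 1)"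
    using has_real_derivative_ray[of f 0 1 x] lhscb_differentiable[OF x] by simp
  then have "((\<lambda>t. f x - \<nu> * ln t) has_real_derivative x \<bullet> grad f x) (at 1)"
    by (rule has_field_derivative_transform_within_open[where S = "{0<..}"])
      (auto simp: lhscb_log_homogeneous[OF x])
  moreover have "((\<lambda>t. f x - \<nu> * ln t) has_real_derivative - \<nu>) (at 1)"
    by (auto intro!: derivative_eq_intros)
  ultimately show ?thesis
    by (rule DERIV_unique)
qed

text \<open>Differentiate the homogeneity identity in \<open>x\<close> for fixed
  \<open>t\<close>.\<close>

lemma lhscb_grad_scaleR:
  assumes x: "x \<in> interior C" and t: "0 < t"
  shows "grad f (t *\<^sub>R x) = (1 / t) *\<^sub>R grad f x"
proof -
  have "t *\<^sub>R x \<in> interior C"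
    using convex_cone_interior_scaleR[OF lhscb_convex_cone x t] .
  note D = has_derivative_grad[OF lhscb_differentiable[OF this]]
  have "((\<lambda>x. t *\<^sub>R x) has_derivative (\<lambda>h. t *\<^sub>R h)) (at x)"
    by (auto intro!: derivative_eq_intros)
  from has_derivative_compose[OF this D]
  have "((\<lambda>x. f (t *\<^sub>R x)) has_derivative (\<lambda>h. t *\<^sub>R h \<bullet> grad f (t *\<^sub>R x))) (at x)" .
  then have "((\<lambda>x. f x - \<nu> * ln t) has_derivative (\<lambda>h. t *\<^sub>R h \<bullet> grad f (t *\<^sub>R x))) (at x)"
    using open_interior x
    by (rule has_derivative_transform_within_open) (simp add: lhscb_log_homogeneous t)
  moreover have "((\<lambda>x. f x - \<nu> * ln t) has_derivative (\<lambda>h. h \<bullet> grad f x)) (at x)"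
    using has_derivative_diff[OF has_derivative_grad[OF lhscb_differentiable[OF x]] has_derivative_const]
    by simp
  ultimately have "(\<lambda>h. t *\<^sub>R h \<bullet> grad f (t *\<^sub>R x)) = (\<lambda>h. h \<bullet> grad f x)"
    by (rule has_derivative_unique)
  then have "h \<bullet> (t *\<^sub>R grad f (t *\<^sub>R x)) = h \<bullet> grad f x" for h
    by (metis inner_scaleR_left inner_scaleR_right)
  then have "t *\<^sub>R grad f (t *\<^sub>R x) = grad f x"
    by (metis vector_eq_ldot)
  then have "(1 / t) *\<^sub>R grad f x = (1 / t) *\<^sub>R (t *\<^sub>R grad f (t *\<^sub>R x))"
    by simp
  with t show ?thesis
    by simp
qed

text \<open>Differentiate the scaling law of the gradient in \<open>t\<close> at 1.\<close>

lemma lhscb_hessian_self: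
  assumes x: "x \<in> interior C"
  shows "hessian f x *v x = - grad f x"
proof -
  have "((\<lambda>t. t *\<^sub>R x) has_derivative (\<lambda>h. h *\<^sub>R x)) (at 1)"
    by (auto intro!: derivative_eq_intros)
  from has_derivative_compose[OF this, of "grad f" "\<lambda>h. hessian f x *v h"]
  have "((\<lambda>t. grad f (t *\<^sub>R x)) has_derivative (\<lambda>h. hessian f x *v (h *\<^sub>R x))) (at 1)"
    using has_derivative_hessian[OF lhscb_grad_differentiable[OF x]] by simp
  then have "((\<lambda>t. (1 / t) *\<^sub>R grad f x) has_derivative (\<lambda>h. hessian f x *v (h *\<^sub>R x))) (at 1)"
    by (rule has_derivative_transform_within_open[where s = "{0<..}"])
      (auto simp: lhscb_grad_scaleR[OF x])
  moreover have "((\<lambda>t. (1 / t) *\<^sub>R grad f x) has_derivative (\<lambda>h. - h *\<^sub>R grad f x)) (at 1)"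
    by (auto intro!: derivative_eq_intros)
  ultimately have "(\<lambda>h. hessian f x *v (h *\<^sub>R x)) = (\<lambda>h. - h *\<^sub>R grad f x)"
    by (rule has_derivative_unique)
  from fun_cong[OF this, of 1] show ?thesis
    by simp
qed

text \<open>Along an interior ray \<open>f\<close> changes only logarithmically, yet it stays above
  its tangent at \<open>s\<close>; hence the tangent cannot have positive slope in that
  direction.\<close>

lemma lhscb_grad_nonpos:
  assumes s: "s \<in> interior C" and u: "u \<in> C"
  shows "u \<bullet> grad f s \<le> 0"
proof -
  have interior_nonpos: "v \<bullet> grad f s \<le> 0" if v: "v \<in> interior C" for v
  proof (rule tendsto_lowerbound)
    \<comment> \<open>The gradient inequality at \<open>t *\<^sub>R v\<close>, divided by \<open>t\<close>.\<close>
    show "\<forall>\<^sub>F t in at_top. v \<bullet> grad f s \<le> (f v - \<nu> * ln t - f s - \<nu>) / t"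
      using eventually_gt_at_top[of 0]
    proof eventually_elim
      case (elim t)
      have "(t *\<^sub>R v - s) \<bullet> grad f s \<le> f (t *\<^sub>R v) - f s"
        using s convex_cone_interior_scaleR[OF lhscb_convex_cone v elim]
        by (intro strictly_convex_gradient_le[OF lhscb_strictly_convex] lhscb_differentiable)
      then show ?case
        using elim lhscb_grad_inner_self[OF s] lhscb_log_homogeneous[OF v elim]
        by (simp add: inner_diff_left field_simps)
    qed
    show "((\<lambda>t. (f v - \<nu> * ln t - f s - \<nu>) / t) \<longlongrightarrow> 0) at_top"
      by real_asymp
  qed simp
  \<comment> \<open>An arbitrary \<open>u\<close> in the cone is the limit of the interior points
    \<open>u + \<epsilon> *\<^sub>R s\<close>.\<close>
  have "((\<lambda>\<epsilon>. (u + \<epsilon> *\<^sub>R s) \<bullet> grad f s) \<longlongrightarrow> (u + 0 *\<^sub>R s) \<bullet> grad f s) (at_right 0)"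
    by (intro tendsto_intros)
  moreover have "\<forall>\<^sub>F \<epsilon> in at_right 0. (u + \<epsilon> *\<^sub>R s) \<bullet> grad f s \<le> 0"
    using eventually_at_right_less
  proof eventually_elim
    case (elim \<epsilon>)
    have "\<epsilon> *\<^sub>R s + u \<in> interior C"
      by (intro convex_cone_interior_add convex_cone_interior_scaleR lhscb_convex_cone s u elim)
    from interior_nonpos[OF this] show ?case
      by (simp add: add.commute)
  qed
  ultimately have "(u + 0 *\<^sub>R s) \<bullet> grad f s \<le> 0"
    by (rule tendsto_upperbound) simp
  then show ?thesis
    by simp
qed

text \<open>If the slope at \<open>s\<close> in direction \<open>u\<close> were 0, the strict
  tangent inequality at \<open>s\<close> would give \<open>f s < f (s + u)\<close>. The one at
  \<open>s + u\<close>, where the slope is nonpositive, gives the reverse.\<close>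

lemma lhscb_grad_neg:
  assumes s: "s \<in> interior C" and u: "u \<in> C" "u \<noteq> 0"
  shows "u \<bullet> grad f s < 0"
proof (rule ccontr)
  assume "\<not> u \<bullet> grad f s < 0"
  then have "u \<bullet> grad f s = 0"
    using lhscb_grad_nonpos[OF s u(1)] by simp
  have su: "s + u \<in> interior C"
    using lhscb_convex_cone s u(1) by (rule convex_cone_interior_add)
  note less = strictly_convex_gradient_less[OF lhscb_strictly_convex lhscb_differentiable]
  have "(s + u - s) \<bullet> grad f s < f (s + u) - f s"
    using s su u(2) by (intro less) auto
  moreover have "(s - (s + u)) \<bullet> grad f (s + u) < f s - f (s + u)"
    using s su u(2) by (intro less) auto
  moreover have "u \<bullet> grad f (s + u) \<le> 0"
    using lhscb_grad_nonpos[OF su u(1)] .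
  ultimately show False
    using \<open>u \<bullet> grad f s = 0\<close> by simp
qed

end

text \<open>Interior membership, rather than mere membership in \<open>K\<close>, is what leaves
  room for a neighborhood of the central point.\<close>

lemma neg_grad_in_interior:
  assumes "proper_cone K" and lhscb: "lhscb \<nu> (dual_cone K) f"
    and s: "s \<in> interior (dual_cone K)" and \<tau>: "0 < \<tau>"
  shows "- \<tau> *\<^sub>R grad f s \<in> interior K"
proof (rule interior_if_pos_on_dual_cone)
  fix u assume "u \<in> dual_cone K" "u \<noteq> 0"
  then have "u \<bullet> grad f s < 0"
    using lhscb_grad_neg[OF lhscb s] by blast
  then show "0 < (- \<tau> *\<^sub>R grad f s) \<bullet> u"
    using \<tau> by (simp add: inner_commute mult_pos_neg)
qed (use assms in \<open>auto simp: proper_cone_def\<close>)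

section \<open>Duality and the central path\<close>

text \<open>The gap \<open>c \<bullet> x - b \<bullet> y\<close> equals
  \<open>x \<bullet> s\<close>.\<close>

lemma weak_duality:
  assumes "x \<in> primal_feasible K A b" and "(y, s) \<in> dual_feasible K A c"
  shows "b \<bullet> y \<le> c \<bullet> x"
proof -
  have "c = s + y v* A" "0 \<le> x \<bullet> s" "A *v x = b"
    using assms by (auto simp: primal_feasible_def dual_feasible_def dual_cone_def)
  then show ?thesis
    by (simp add: inner_add_left dot_lmul_matrix inner_commute[of x s] inner_commute[of b y])
qed

text \<open>The real infimum needs a non-empty set bounded below: \<open>x\<close> provides the
  former, weak duality with \<open>(y, s)\<close> the latter.\<close>

lemma primal_value_bounds:
  assumes x: "x \<in> primal_feasible K A b" and ys: "(y, s) \<in> dual_feasible K A c"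
  shows "b \<bullet> y \<le> primal_value K A b c" "primal_value K A b c \<le> c \<bullet> x"
proof -
  have lower: "b \<bullet> y \<le> v" if "v \<in> (\<lambda>x. c \<bullet> x) ` primal_feasible K A b" for v
    using that weak_duality ys by blast
  then show "b \<bullet> y \<le> primal_value K A b c"
    unfolding primal_value_def using x by (intro cInf_greatest) auto
  show "primal_value K A b c \<le> c \<bullet> x"
    unfolding primal_value_def using x lower by (intro cInf_lower bdd_belowI) auto
qed

section \<open>The vector \<open>x_gamma\<close>: its equations, uniqueness and continuity\<close>

lemma A_c_x_gamma:
  assumes "invertible (normal_matrix f c A y)"
  shows "A_c c A *v x_gamma f c A b y \<gamma> = stack \<gamma> (- b)"
proof -
  have "A_c c A *v x_gamma f c A b y \<gamma>
      = normal_matrix f c A y *v (matrix_inv (normal_matrix f c A y) *v stack \<gamma> (- b))"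
    unfolding x_gamma_def
    by (simp only: matrix_vector_mul_assoc matrix_mul_assoc normal_matrix_def)
  with matrix_inv_mult(1)[OF assms] show ?thesis
    by simp
qed

lemma x_gamma_solves:
  assumes "invertible (normal_matrix f c A y)"
  shows "A *v x_gamma f c A b y \<gamma> = b" "c \<bullet> x_gamma f c A b y \<gamma> = \<gamma>"
  using A_c_x_gamma[OF assms, of b \<gamma>] by (auto simp: A_c_mult)

text \<open>Applying \<open>A_c c A\<close> to \<open>x\<close> gives the normal matrix times
  \<open>w\<close>, so the two constraints determine \<open>w\<close>. This serves to recognize the
  central primal point.\<close>

lemma x_gamma_eqI:
  assumes "invertible (normal_matrix f c A y)"
    and x: "x = hessian f (upsilon c A y) *v (transpose (A_c c A) *v w)"
    and b: "A *v x = b" and \<gamma>: "c \<bullet> x = \<gamma>"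
  shows "x_gamma f c A b y \<gamma> = x"
proof -
  have "normal_matrix f c A y *v w = stack \<gamma> (- b)"
    unfolding b[symmetric] \<gamma>[symmetric] A_c_mult[symmetric] x normal_matrix_def
    by (simp only: matrix_vector_mul_assoc matrix_mul_assoc)
  then have "matrix_inv (normal_matrix f c A y) *v stack \<gamma> (- b) = w"
    using matrix_inv_mult(2)[OF assms(1)] by metis
  then show ?thesis
    unfolding x_gamma_def x by (simp only: matrix_vector_mul_assoc[symmetric])
qed

lemma tendsto_stack:
  fixes v :: "'a \<Rightarrow> real^'m"
  assumes "(a \<longlongrightarrow> a0) F" "(v \<longlongrightarrow> v0) F"
  shows "((\<lambda>x. stack (a x) (v x)) \<longlongrightarrow> stack a0 v0) F"
  unfolding stack_def
proof (rule tendsto_vec_lambda)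
  fix i :: "'m option"
  show "((\<lambda>x. case i of None \<Rightarrow> a x | Some j \<Rightarrow> v x $ j) \<longlongrightarrow>
      (case i of None \<Rightarrow> a0 | Some j \<Rightarrow> v0 $ j)) F"
    using assms by (cases i) (auto intro: tendsto_vec_nth)
qed

lemma tendsto_upsilon: "((\<lambda>y. upsilon c A y) \<longlongrightarrow> upsilon c A y) (nhds y)"
  unfolding upsilon_eq
  by (intro tendsto_intros tendsto_matrix_vector_mult filterlim_ident)

text \<open>The value \<gamma> may vary with \<open>y\<close>, as the choice
  \<open>b \<bullet> y + \<nu> * \<tau>\<close> does.\<close>

lemma tendsto_x_gamma:
  assumes cont: "isCont (hessian f) (upsilon c A y)"
    and inv: "invertible (normal_matrix f c A y)"
    and \<gamma>: "(\<gamma> \<longlongrightarrow> \<gamma>0) (nhds y)"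
  shows "((\<lambda>y. x_gamma f c A b y (\<gamma> y)) \<longlongrightarrow> x_gamma f c A b y \<gamma>0) (nhds y)"
proof -
  have H: "((\<lambda>y. hessian f (upsilon c A y)) \<longlongrightarrow> hessian f (upsilon c A y)) (nhds y)"
    using cont tendsto_upsilon by (rule isCont_tendsto_compose)
  then have "((\<lambda>y. normal_matrix f c A y) \<longlongrightarrow> normal_matrix f c A y) (nhds y)"
    unfolding normal_matrix_def by (intro tendsto_matrix_mult tendsto_const)
  from tendsto_matrix_inv_mult[OF this tendsto_stack[OF \<gamma> tendsto_const] inv]
  show ?thesis
    \<comment> \<open>Rebracketing lets the inverse act on a vector, the form covered by
      \<open>tendsto_matrix_inv_mult\<close>.\<close>
    unfolding x_gamma_def matrix_vector_mul_assoc[symmetric]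
    by (intro tendsto_matrix_vector_mult[OF H] tendsto_matrix_vector_mult[OF tendsto_const])
qed

text \<open>With the first coordinate fixed at 1, the central point minimizes a differentiable
  function over an open set of \<open>y\<close>, so the derivative vanishes there.\<close>

lemma dual_central_point_stationary:
  assumes cp: "dual_central_point K f c A b \<tau> y\<^sub>\<tau>"
    and dom: "\<And>y. stack 1 y \<in> interior (dual_cone (K_cA K c A))
               \<longleftrightarrow> upsilon c A y \<in> interior (dual_cone K)"
    and diff: "\<And>x. x \<in> interior (dual_cone K) \<Longrightarrow> f differentiable (at x)"
  shows "upsilon c A y\<^sub>\<tau> \<in> interior (dual_cone K)"
    and "A *v (- \<tau> *\<^sub>R grad f (upsilon c A y\<^sub>\<tau>)) = b"
proof -
  let ?s = "upsilon c A y\<^sub>\<tau>" and ?S = "{y. upsilon c A y \<in> interior (dual_cone K)}"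
  let ?\<phi> = "\<lambda>y. \<tau> * f (upsilon c A y) - b \<bullet> y"
  have stack_val: "f_cA f c A (stack 1 y) = f (upsilon c A y)" for y
    by (simp add: f_cA_stack upsilon_eq)
  show s: "?s \<in> interior (dual_cone K)"
    using cp unfolding dual_central_point_def unique_minimizer_def is_arg_min_def by (auto simp: dom)
  have min: "\<forall>y\<in>?S. ?\<phi> y\<^sub>\<tau> \<le> ?\<phi> y"
    using cp unfolding dual_central_point_def unique_minimizer_def is_arg_min_linorder
    by (auto simp: dom stack_val)
  have "open ?S"
    unfolding upsilon_eq vimage_def[symmetric]
    by (intro open_vimage open_interior continuous_intros
        linear_continuous_on matrix_vector_mul_bounded_linear)
  have "((\<lambda>y. upsilon c A y) has_derivative (\<lambda>h. - (transpose A *v h))) (at y\<^sub>\<tau>)"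
    unfolding upsilon_eq
    by (auto intro!: derivative_eq_intros
        bounded_linear.has_derivative[OF matrix_vector_mul_bounded_linear] simp del: transpose_matrix_vector)
  from has_derivative_compose[OF this has_derivative_grad[OF diff[OF s]]]
  have "(?\<phi> has_derivative (\<lambda>h. \<tau> * (- (transpose A *v h) \<bullet> grad f ?s) - b \<bullet> h)) (at y\<^sub>\<tau>)"
    by (intro has_derivative_diff has_derivative_mult_right has_derivative_inner_right has_derivative_ident)
  with s \<open>open ?S\<close> min have "(\<lambda>h. \<tau> * (- (transpose A *v h) \<bullet> grad f ?s) - b \<bullet> h) = (\<lambda>h. 0)"
    by (intro differential_zero_maxmin[where S = ?S]) auto
  \<comment> \<open>The vanishing derivative, with \<open>transpose A\<close> moved across the inner
    product.\<close>
  then have "h \<bullet> (A *v (- \<tau> *\<^sub>R grad f ?s)) = h \<bullet> b" for h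
    by (auto simp: fun_eq_iff dot_lmul_matrix inner_commute[of b] matrix_vector_mult_scaleR
        simp del: scaleR_minus_left
        dest!: spec[of _ h])
  then show "A *v (- \<tau> *\<^sub>R grad f ?s) = b"
    by (metis vector_eq_ldot)
qed

theorem theorem6p1:
  fixes K :: "(real^'n) set" and f :: "real^'n \<Rightarrow> real" and \<nu> :: real
    and A :: "real^'n^'m" and b :: "real^'m" and c :: "real^'n"
  assumes "proper_cone K"
    and "lhscb \<nu> (dual_cone K) f"
    and "primal_feasible K A b \<noteq> {}"
    and "dual_feasible K A c \<noteq> {}"
    and "independent_rows (A_c c A)"
    and "interior (dual_cone (K_cA K c A)) \<noteq> {}"
    and "interior (dual_cone (K_cA K c A)) =
           {stack y\<^sub>0 y | y\<^sub>0 y. y\<^sub>0 *\<^sub>R c - transpose A *v y \<in> interior (dual_cone K)}"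
    and "lhscb \<nu> (dual_cone (K_cA K c A)) (f_cA f c A)"
  shows "(\<forall>y. stack 1 y \<in> interior (dual_cone (K_cA K c A)) \<longleftrightarrow>
              (\<exists>s \<in> interior (dual_cone K). (y, s) \<in> dual_feasible K A c)) \<and>
         (\<forall>y \<gamma>. stack 1 y \<in> interior (dual_cone (K_cA K c A)) \<longrightarrow>
            invertible (normal_matrix f c A y) \<and>
            A *v x_gamma f c A b y \<gamma> = b \<and> c \<bullet> x_gamma f c A b y \<gamma> = \<gamma>) \<and>
         (\<forall>\<tau>>0. \<forall>y\<^sub>\<tau>. dual_central_point K f c A b \<tau> y\<^sub>\<tau> \<longrightarrow>
            (\<forall>\<^sub>F y in nhds y\<^sub>\<tau>. \<forall>\<gamma>. \<gamma> = b \<bullet> y + \<nu> * \<tau> \<longrightarrow>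
               x_gamma f c A b y \<gamma> \<in> K \<and>
               x_gamma f c A b y \<gamma> \<in> primal_feasible K A b \<and>
               \<bar>c \<bullet> x_gamma f c A b y \<gamma> - primal_value K A b c\<bar> \<le> \<nu> * \<tau>))"
proof -
  note barrier = \<open>lhscb \<nu> (dual_cone K) f\<close>
  let ?U = "interior (dual_cone K)"
  have dom: "stack 1 y \<in> interior (dual_cone (K_cA K c A)) \<longleftrightarrow> upsilon c A y \<in> ?U" for y
    unfolding assms(7) upsilon_eq by force
  have dual: "(y, upsilon c A y) \<in> dual_feasible K A c" if "upsilon c A y \<in> ?U" for y
    using that interior_subset by (auto simp: dual_feasible_def upsilon_eq)
  have inv: "invertible (normal_matrix f c A y)" if "upsilon c A y \<in> ?U" for y
    unfolding normal_matrix_def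
    using lhscb_hessian_pos[OF barrier that] \<open>independent_rows (A_c c A)\<close>
    by (rule invertible_congruence)
  \<comment> \<open>The dual equation determines the slack from \<open>y\<close>; it is
    \<open>upsilon c A y\<close>.\<close>
  have 1: "upsilon c A y \<in> ?U \<longleftrightarrow> (\<exists>s\<in>?U. (y, s) \<in> dual_feasible K A c)" for y
  proof
    assume "\<exists>s\<in>?U. (y, s) \<in> dual_feasible K A c"
    then obtain s where "s \<in> ?U" "transpose A *v y + s = c"
      by (auto simp: dual_feasible_def)
    moreover from this have "s = upsilon c A y"
      by (auto simp: upsilon_eq)
    ultimately show "upsilon c A y \<in> ?U"
      by simp
  qed (use dual in blast)
  have 3: "\<forall>\<^sub>F y in nhds y\<^sub>\<tau>. \<forall>\<gamma>. \<gamma> = b \<bullet> y + \<nu> * \<tau> \<longrightarrow>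
               x_gamma f c A b y \<gamma> \<in> K \<and>
               x_gamma f c A b y \<gamma> \<in> primal_feasible K A b \<and>
               \<bar>c \<bullet> x_gamma f c A b y \<gamma> - primal_value K A b c\<bar> \<le> \<nu> * \<tau>"
    if \<tau>: "0 < \<tau>" and cp: "dual_central_point K f c A b \<tau> y\<^sub>\<tau>" for \<tau> y\<^sub>\<tau>
  proof -
    let ?s = "upsilon c A y\<^sub>\<tau>"
    let ?x = "- \<tau> *\<^sub>R grad f ?s" and ?\<gamma> = "\<lambda>y. b \<bullet> y + \<nu> * \<tau>"
    note stationary = dual_central_point_stationary[OF cp dom lhscb_differentiable[OF barrier]]
    have s: "?s \<in> ?U" and Ax: "A *v ?x = b"
      using stationary by blast+
    \<comment> \<open>Splitting \<open>c\<close> as slack plus transposed constraint part: the slack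
      contributes \<open>\<nu> * \<tau>\<close>, the rest
      \<open>b \<bullet> y\<^sub>\<tau>\<close>.\<close>
    have "c \<bullet> ?x = ?s \<bullet> ?x + (y\<^sub>\<tau> v* A) \<bullet> ?x"
      by (simp add: upsilon_eq inner_diff_left algebra_simps)
    also have "(y\<^sub>\<tau> v* A) \<bullet> ?x = b \<bullet> y\<^sub>\<tau>"
      unfolding dot_lmul_matrix Ax by (rule inner_commute)
    also have "?s \<bullet> ?x = \<nu> * \<tau>"
      using lhscb_grad_inner_self[OF barrier s] by simp
    finally have cx: "c \<bullet> ?x = ?\<gamma> y\<^sub>\<tau>"
      by simp
    \<comment> \<open>The Hessian sends \<open>?s\<close> to minus the gradient. This exhibits
      \<open>?x\<close> in the form required by \<open>x_gamma_eqI\<close>, with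
      \<open>w = \<tau> *\<^sub>R stack 1 y\<^sub>\<tau>\<close>.\<close>
    have "?x = hessian f ?s *v (\<tau> *\<^sub>R ?s)"
      using lhscb_hessian_self[OF barrier s] by (simp add: matrix_vector_mult_scaleR)
    also have "\<tau> *\<^sub>R ?s = transpose (A_c c A) *v (\<tau> *\<^sub>R stack 1 y\<^sub>\<tau>)"
      by (simp only: upsilon_def matrix_vector_mult_scaleR)
    finally have "x_gamma f c A b y\<^sub>\<tau> (?\<gamma> y\<^sub>\<tau>) = ?x"
      by (rule x_gamma_eqI[OF inv[OF s] _ Ax cx])
    moreover have "((\<lambda>y. x_gamma f c A b y (?\<gamma> y)) \<longlongrightarrow> x_gamma f c A b y\<^sub>\<tau> (?\<gamma> y\<^sub>\<tau>)) (nhds y\<^sub>\<tau>)"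
      by (intro tendsto_x_gamma lhscb_isCont_hessian[OF barrier s] inv[OF s] tendsto_intros filterlim_ident)
    ultimately have "((\<lambda>y. x_gamma f c A b y (?\<gamma> y)) \<longlongrightarrow> ?x) (nhds y\<^sub>\<tau>)"
      by simp
    from topological_tendstoD[OF this open_interior neg_grad_in_interior[OF \<open>proper_cone K\<close> barrier s \<tau>]]
    have "\<forall>\<^sub>F y in nhds y\<^sub>\<tau>. x_gamma f c A b y (?\<gamma> y) \<in> interior K" .
    \<comment> \<open>Nearby \<open>y\<close> must also stay strictly dual feasible, for
      invertibility of the normal matrix and for weak duality.\<close>
    moreover have "\<forall>\<^sub>F y in nhds y\<^sub>\<tau>. upsilon c A y \<in> ?U"
      by (rule topological_tendstoD[OF tendsto_upsilon open_interior s])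
    ultimately show ?thesis
    proof eventually_elim
      case (elim y)
      let ?z = "x_gamma f c A b y (?\<gamma> y)"
      have z: "?z \<in> K"
        using elim interior_subset by blast
      then have feas: "?z \<in> primal_feasible K A b"
        using x_gamma_solves(1)[OF inv[OF elim(2)]] by (simp add: primal_feasible_def)
      \<comment> \<open>The primal value lies between \<open>b \<bullet> y\<close> and
        \<open>c \<bullet> ?z\<close>, which differ by exactly
        \<open>\<nu> * \<tau>\<close>.\<close>
      have "c \<bullet> ?z = ?\<gamma> y"
        using x_gamma_solves(2)[OF inv[OF elim(2)]] .
      with primal_value_bounds[OF feas dual[OF elim(2)]]
      have "\<bar>c \<bullet> ?z - primal_value K A b c\<bar> \<le> \<nu> * \<tau>"
        by linarith
      with z feas show ?case
        by blast
    qed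
  qed
  show ?thesis
    unfolding dom by (intro conjI allI impI 1 3 inv x_gamma_solves)
qed

end
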